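(* For all positive integers $\ell,m$, we have $\#\mathcal P^\ell(\Omega_m)=b_{\ell,m-1}$.
   Context: A partition with $n$ parts is a sequence $\mu=(\mu_1\ge\cdots\ge\mu_n>0)$ of positive integers. For $0<j\le\mu_n$ write $(\mu:j)=(\mu_1\ge\cdots\ge\mu_n\ge j)$. For positive integers $n,k$, $\mathcal P^{n,k}$ is the set of partitions with exactly $n$ parts and $\mu_1\le k$; $\tau_k:\mathcal P^{n,k}\to\mathcal P^{n,k}$ is the involution $\tau_k(\mu_1\ge\cdots\ge\mu_n)=(k+1-\mu_n\ge\cdots\ge k+1-\mu_1)$. For a positive integer $m$ let $\Omega_m=\mathcal P^{1,m}$ be the set of one-part partitions $(j)$, $1\le j\le m$. Define subsets $\mathcal P^\ell(\Omega_m)\subset\mathcal P^{\ell,\ell+m-1}$ inductively by $\mathcal P^1_{\mathrm d}(\Omega_m)=\mathcal P^1_\tau(\Omega_m)=\Omega_m$; for $\ell\ge2$, $\mathcal P^\ell_{\mathrm d}(\Omega_m)=\{(\mu:j)\in\mathcal P^{\ell,\ell+m-1}: \mu\in\mathcal P^{\ell-1}(\Omega_m),\ 1\le j\le\mu_{\ell-1}\}$ and $\mathcal P^\ell_\tau(\Omega_m)=\tau_{\ell+m-1}\mathcal P^\ell_{\mathrm d}(\Omega_m)$; and $\mathcal P^\ell(\Omega_m)=\mathcal P^\ell_{\mathrm d}(\Omega_m)\cup\mathcal P^\ell_\tau(\Omega_m)$ for all $\ell\ge 1$. The ballot numbers are $b_{\ell,m}=\binom{2\ell+m}{\ell}-\binom{2\ell+m}{\ell-1}$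 for $\ell,m\ge0$ (with $\binom{n}{-1}=0$). *)

theory Defs
  imports Main
begin

text \<open>A partition \<open>\<mu>\<^sub>1 \<ge> \<dots> \<ge> \<mu>\<^sub>n > 0\<close> is the list \<open>[\<mu>\<^sub>1, \<dots>, \<mu>\<^sub>n]\<close>;
  the partition \<open>(\<mu> : j)\<close> is \<open>\<mu> @ [j]\<close>.\<close>

definition is_partition :: "nat list \<Rightarrow> bool" where
  "is_partition \<mu> \<longleftrightarrow> sorted_wrt (\<ge>) \<mu> \<and> (\<forall>x\<in>set \<mu>. 0 < x)"

text \<open>For weakly decreasing lists of positive length, the bound on all parts amounts to
  \<open>\<mu>\<^sub>1 \<le> k\<close>.\<close>

definition partitions :: "nat \<Rightarrow> nat \<Rightarrow> nat list set" where
  "partitions n k = {\<mu>. is_partition \<mu> \<and> length \<mu> = n \<and> (\<forall>x\<in>set \<mu>. x \<le> k)}"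

definition tau :: "nat \<Rightarrow> nat list \<Rightarrow> nat list" where
  "tau k \<mu> = rev (map (\<lambda>x. k + 1 - x) \<mu>)"

definition Omega :: "nat \<Rightarrow> nat list set" where
  "Omega m = partitions 1 m"

text \<open>The index \<open>\<ell>\<close> starts at 1; the value at 0 is a dummy and is not used by the
  recursion.\<close>

fun P_d :: "nat \<Rightarrow> nat \<Rightarrow> nat list set"
  and P_tau :: "nat \<Rightarrow> nat \<Rightarrow> nat list set"
  and P_Omega :: "nat \<Rightarrow> nat \<Rightarrow> nat list set"
where
  "P_d 0 m = {}"
| "P_d (Suc 0) m = Omega m"
| "P_d (Suc (Suc l)) m =
     {\<mu> @ [j] | \<mu> j. \<mu> @ [j] \<in> partitions (Suc (Suc l)) (Suc (Suc l) + m - 1)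
        \<and> \<mu> \<in> P_Omega (Suc l) m \<and> 1 \<le> j \<and> j \<le> last \<mu>}"
| "P_tau 0 m = {}"
| "P_tau (Suc 0) m = Omega m"
| "P_tau (Suc (Suc l)) m = tau (Suc (Suc l) + m - 1) ` P_d (Suc (Suc l)) m"
| "P_Omega l m = P_d l m \<union> P_tau l m"

definition ballot :: "nat \<Rightarrow> nat \<Rightarrow> int" where
  "ballot l m = int ((2 * l + m) choose l)
     - (if l = 0 then 0 else int ((2 * l + m) choose (l - 1)))"

end

theory Submission
  imports Defs
begin

text \<open>Write \<open>k = \<ell> + m - 1\<close> for the bound on the parts at length \<open>\<ell>\<close>. Since \<open>\<tau>\<close> turns
  \<open>(\<mu> : j)\<close> into the partition obtained by raising all parts of \<open>\<tau> \<mu>\<close> by one and putting a new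
  largest part in front, \<open>P_Omega\<close> is generated from the one-part partitions by two operations:
  appending a new last part, and raising all parts by one before prepending a new first part.
  Reading them backwards, a partition reduces either by dropping its last part (possible
  if its first part is below \<open>k\<close>) or by dropping its first part and lowering the others by one
  (possible if its last part exceeds 1), and it lies in \<open>P_Omega\<close> iff it reduces to a
  single part.

  The key point is that the order of reductions does not matter. When both
  are possible, they commute, so by induction a member of \<open>P_Omega\<close> stays a member
  under every reduction that is possible (\<open>butlast_in_P_Omega\<close> and its mirror image under
  \<open>\<tau>\<close>). A longer partition with first part \<open>k\<close> and last part 1 cannot be reduced and so is never
  a member (\<open>P_Omega_not_extremal\<close>).

  To count, one records how far a member stays from the two extremes: let \<open>G(p, q)\<close> be the
  number of members of length \<open>\<ell>\<close> with \<open>\<mu>\<^sub>1 \<le> k - p\<close> and \<open>\<mu>\<^sub>\<ell> > q\<close>. Removing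
  the last part gives the Pascal-like recursion \<open>card_P_slack_Suc\<close> for \<open>p \<ge> 1\<close>, the involution
  \<open>\<tau>\<close> exchanges \<open>p\<close> and \<open>q\<close>, and the absence of extremal members determines \<open>G(0, 0)\<close> by
  inclusion and exclusion (\<open>card_P_slack_0_0\<close>). The solution (\<open>card_P_slack\<close>) is
  \<open>G(p, q) = (N choose \<ell>) - (N choose (\<ell> + m))\<close> with \<open>N = 2\<ell> + m - 2 - p - q\<close>. Here the first
  term counts all partitions within these bounds, and the subtracted
  term has the shape of a count of reflected lattice paths. For \<open>p = q = 0\<close>
  Pascal's rule and the symmetry of binomial coefficients turn this into the ballot number.\<close>

section \<open>The involution on bounded partitions\<close>

lemma tau_in_partitions:
  assumes "\<mu> \<in> partitions n k"
  shows "tau k \<mu> \<in> partitions n k"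
proof -
  have "Suc (k - x) \<le> k" if "0 < x" "x \<le> k" for x :: nat
    using that by simp
  with assms show ?thesis
    by (auto simp: partitions_def tau_def is_partition_def sorted_wrt_map sorted_wrt_rev Suc_diff_le
        elim!: sorted_wrt_mono_rel[rotated])
qed

lemma tau_tau:
  assumes "\<mu> \<in> partitions n k"
  shows "tau k (tau k \<mu>) = \<mu>"
proof -
  have "Suc k - (Suc k - x) = x" if "x \<in> set \<mu>" for x
    using assms that by (force simp: partitions_def)
  then have "map (\<lambda>x. Suc k - (Suc k - x)) \<mu> = \<mu>"
    by (rule map_idI)
  then show ?thesis
    by (simp add: tau_def rev_map comp_def)
qed

lemma hd_tau: "\<mu> \<noteq> [] \<Longrightarrow> hd (tau k \<mu>) = k + 1 - last \<mu>"
  by (simp add: tau_def hd_rev last_map)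

lemma last_tau: "\<mu> \<noteq> [] \<Longrightarrow> last (tau k \<mu>) = k + 1 - hd \<mu>"
  by (simp add: tau_def last_rev hd_map)

text \<open>This is how \<open>\<tau>\<close> exchanges the two ways of lengthening a partition. The bounds
  for \<open>\<mu>\<close> and for \<open>\<mu> @ [j]\<close> differ by one, which produces the shift of the old parts.\<close>

lemma tau_append:
  assumes "\<mu> \<in> partitions n k"
  shows "tau (Suc k) (\<mu> @ [j]) = (k + 2 - j) # map Suc (tau k \<mu>)"
proof -
  have "Suc (Suc k) - x = Suc (Suc k - x)" if "x \<in> set \<mu>" for x
    using assms that by (intro Suc_diff_le) (auto simp: partitions_def le_SucI)
  then show ?thesis
    by (simp add: tau_def rev_map)
qed

lemma finite_partitions: "finite (partitions n k)"
proof (rule finite_subset)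
  show "partitions n k \<subseteq> {xs. set xs \<subseteq> {..k} \<and> length xs = n}"
    by (auto simp: partitions_def)
qed (simp add: finite_lists_length_eq)

text \<open>This makes the membership in \<open>partitions\<close> that the definition of \<open>P_d\<close> requires
  automatic, so that \<open>P_d\<close> admits all appended parts that keep the list decreasing.\<close>

lemma append_in_partitions:
  assumes "\<mu> \<in> partitions n k" "0 < j" "j \<le> last \<mu>" "0 < n"
  shows "\<mu> @ [j] \<in> partitions (Suc n) (Suc k)"
proof -
  have ne: "\<mu> \<noteq> []" and srt: "sorted_wrt (\<ge>) \<mu>" and le: "\<forall>x\<in>set \<mu>. x \<le> k"
    using assms by (auto simp: partitions_def is_partition_def)
  have "sorted_wrt (\<ge>) (butlast \<mu> @ [last \<mu>])" using ne srt by simp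
  then have "last \<mu> \<le> x" if "x \<in> set (butlast \<mu> @ [last \<mu>])" for x
    using that by (auto simp: sorted_wrt_append)
  then have "last \<mu> \<le> x" if "x \<in> set \<mu>" for x
    using ne that by simp
  then have "j \<le> x" if "x \<in> set \<mu>" for x
    using assms(3) that by (meson order_trans)
  moreover from le ne have "j \<le> Suc k"
    using assms(3) by (meson last_in_set le_SucI order_trans)
  ultimately show ?thesis
    using assms(1,2) le by (simp add: partitions_def is_partition_def sorted_wrt_append le_SucI)
qed

section \<open>The two ways to build a member, and their confluence\<close>

text \<open>Lengths are written as \<open>Suc l\<close>, so that the bound on the parts is \<open>l + m\<close>, without
  truncated subtraction.\<close>

declare P_Omega.simps [simp del]

lemma P_Omega_one: "P_Omega (Suc 0) m = partitions 1 m"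
  by (simp add: P_Omega.simps Omega_def)

lemma P_Omega_subset_partitions: "P_Omega (Suc l) m \<subseteq> partitions (Suc l) (l + m)"
proof (cases l)
  case 0
  then show ?thesis by (simp add: P_Omega_one)
next
  case (Suc l')
  then show ?thesis by (auto simp: P_Omega.simps intro: tau_in_partitions)
qed

lemma P_Omega_nonempty: "\<mu> \<in> P_Omega (Suc l) m \<Longrightarrow> \<mu> \<noteq> []"
  using P_Omega_subset_partitions[of l m] by (auto simp: partitions_def)

lemma P_Omega_length: "\<mu> \<in> P_Omega (Suc l) m \<Longrightarrow> length \<mu> = Suc l"
  using P_Omega_subset_partitions[of l m] by (auto simp: partitions_def)

lemma P_Omega_hd_le: "\<mu> \<in> P_Omega (Suc l) m \<Longrightarrow> hd \<mu> \<le> l + m"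
  using P_Omega_subset_partitions[of l m] P_Omega_nonempty[of \<mu> l m] by (auto simp: partitions_def)

lemma P_Omega_last_pos: "\<mu> \<in> P_Omega (Suc l) m \<Longrightarrow> 0 < last \<mu>"
  using P_Omega_subset_partitions[of l m] P_Omega_nonempty[of \<mu> l m]
  by (auto simp: partitions_def is_partition_def)

lemma P_Omega_last_le: "\<mu> \<in> P_Omega (Suc l) m \<Longrightarrow> last \<mu> \<le> l + m"
  using P_Omega_subset_partitions[of l m] P_Omega_nonempty[of \<mu> l m] by (auto simp: partitions_def)

lemma P_Omega_tau:
  assumes "\<mu> \<in> P_Omega (Suc l) m"
  shows "tau (l + m) \<mu> \<in> P_Omega (Suc l) m"
proof (cases l)
  case 0
  then show ?thesis using assms by (simp add: P_Omega_one tau_in_partitions)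
next
  case (Suc l')
  then have un: "P_Omega (Suc l) m = P_d (Suc l) m \<union> tau (l + m) ` P_d (Suc l) m"
    by (simp add: P_Omega.simps del: P_d.simps)
  then have inv: "tau (l + m) (tau (l + m) x) = x" if "x \<in> P_d (Suc l) m" for x
    using that P_Omega_subset_partitions[of l m] by (intro tau_tau[of _ "Suc l"]) blast
  from assms un consider "\<mu> \<in> P_d (Suc l) m"
    | x where "\<mu> = tau (l + m) x" "x \<in> P_d (Suc l) m"
    by blast
  then show ?thesis
  proof cases
    case 1
    with un show ?thesis by blast
  next
    case 2
    with un inv show ?thesis by simp
  qed
qed

lemma P_d_Suc_Suc:
  "P_d (Suc (Suc l)) m = {\<nu> @ [j] | \<nu> j. \<nu> \<in> P_Omega (Suc l) m \<and> 0 < j \<and> j \<le> last \<nu>}"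
proof -
  have "\<nu> @ [j] \<in> partitions (Suc (Suc l)) (Suc (Suc l) + m - 1)"
    if "\<nu> \<in> P_Omega (Suc l) m" "0 < j" "j \<le> last \<nu>" for \<nu> j
    using that P_Omega_subset_partitions[of l m] append_in_partitions[of \<nu> "Suc l" "l + m" j] by auto
  then have "\<nu> @ [j] \<in> partitions (Suc (Suc l)) (Suc (Suc l) + m - 1) \<and>
        \<nu> \<in> P_Omega (Suc l) m \<and> 1 \<le> j \<and> j \<le> last \<nu>
      \<longleftrightarrow> \<nu> \<in> P_Omega (Suc l) m \<and> 0 < j \<and> j \<le> last \<nu>" for \<nu> j
    by (metis One_nat_def Suc_le_eq)
  then show ?thesis
    by (simp only: P_d.simps)
qed

lemma append_in_P_Omega:
  assumes "\<nu> \<in> P_Omega (Suc l) m" "0 < j" "j \<le> last \<nu>"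
  shows "\<nu> @ [j] \<in> P_Omega (Suc (Suc l)) m"
proof -
  have "\<nu> @ [j] \<in> P_d (Suc (Suc l)) m"
    using assms by (simp add: P_d_Suc_Suc del: P_d.simps)
  then show ?thesis by (simp add: P_Omega.simps(1) del: P_d.simps P_tau.simps)
qed

lemma prepend_in_P_Omega:
  assumes "\<nu> \<in> P_Omega (Suc l) m" "hd \<nu> < i" "i \<le> Suc (l + m)"
  shows "i # map Suc \<nu> \<in> P_Omega (Suc (Suc l)) m"
proof -
  have part: "\<nu> \<in> partitions (Suc l) (l + m)" using assms(1) P_Omega_subset_partitions by blast
  have "tau (l + m) \<nu> @ [l + m + 2 - i] \<in> P_Omega (Suc (Suc l)) m"
    using assms P_Omega_nonempty[OF assms(1)]
    by (intro append_in_P_Omega P_Omega_tau) (auto simp: last_tau)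
  then have "tau (Suc l + m) (tau (l + m) \<nu> @ [l + m + 2 - i]) \<in> P_Omega (Suc (Suc l)) m"
    by (rule P_Omega_tau)
  moreover have "tau (Suc l + m) (tau (l + m) \<nu> @ [l + m + 2 - i]) = i # map Suc \<nu>"
    using tau_append[OF tau_in_partitions[OF part]] tau_tau[OF part] assms(3) by simp
  ultimately show ?thesis by simp
qed

lemma P_Omega_Suc_Suc_cases [consumes 1, case_names app prep]:
  assumes "\<mu> \<in> P_Omega (Suc (Suc l)) m"
  obtains \<nu> j where "\<mu> = \<nu> @ [j]" "\<nu> \<in> P_Omega (Suc l) m" "0 < j" "j \<le> last \<nu>"
    | \<nu> i where "\<mu> = i # map Suc \<nu>" "\<nu> \<in> P_Omega (Suc l) m" "hd \<nu> < i" "i \<le> Suc (l + m)"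
proof -
  consider "\<mu> \<in> P_d (Suc (Suc l)) m"
    | "\<mu> \<in> tau (Suc l + m) ` P_d (Suc (Suc l)) m"
    using assms by (auto simp: P_Omega.simps simp del: P_d.simps)
  then show ?thesis
  proof cases
    case 1
    then show ?thesis using that(1) by (auto simp: P_d_Suc_Suc simp del: P_d.simps)
  next
    case 2
    then obtain \<nu> j where \<nu>: "\<mu> = tau (Suc l + m) (\<nu> @ [j])" "\<nu> \<in> P_Omega (Suc l) m"
        "0 < j" "j \<le> last \<nu>"
      by (auto simp: P_d_Suc_Suc simp del: P_d.simps)
    have part: "\<nu> \<in> partitions (Suc l) (l + m)" using \<nu>(2) P_Omega_subset_partitions by blast
    show ?thesis
    proof (rule that(2))
      show "\<mu> = (l + m + 2 - j) # map Suc (tau (l + m) \<nu>)"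
        using \<nu>(1) tau_append[OF part] by simp
      show "tau (l + m) \<nu> \<in> P_Omega (Suc l) m" by (rule P_Omega_tau) fact
      show "hd (tau (l + m) \<nu>) < l + m + 2 - j"
        using \<nu> P_Omega_nonempty[OF \<nu>(2)] P_Omega_last_le[OF \<nu>(2)] by (simp add: hd_tau)
      show "l + m + 2 - j \<le> Suc (l + m)" using \<nu>(3) by simp
    qed
  qed
qed

text \<open>This is the confluence of the two reductions. The only case to consider is a \<open>\<mu>\<close> built
  by prepending \<open>i\<close> to a raised \<open>\<nu>\<close>. The bound on \<open>i\<close> forces \<open>hd \<nu>\<close> below its own maximum, so
  by induction the last part of \<open>\<nu>\<close> can be removed, and \<open>i\<close> can be prepended to what remains.\<close>

lemma butlast_in_P_Omega:
  assumes "\<mu> \<in> P_Omega (Suc (Suc l)) m" "hd \<mu> \<le> l + m"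
  shows "butlast \<mu> \<in> P_Omega (Suc l) m"
  using assms
proof (induction l arbitrary: \<mu>)
  case 0
  from "0.prems"(1) show ?case
  proof (cases rule: P_Omega_Suc_Suc_cases)
    case (prep \<nu> i)
    then obtain x where "\<nu> = [x]"
      using P_Omega_length[OF prep(2)] by (auto simp: length_Suc_conv)
    with prep "0.prems"(2) show ?thesis
      by (simp add: P_Omega_one partitions_def is_partition_def)
  qed simp
next
  case (Suc l)
  from Suc.prems(1) show ?case
  proof (cases rule: P_Omega_Suc_Suc_cases)
    case (prep \<nu> i)
    have \<nu>: "\<nu> \<noteq> []" "length \<nu> = Suc (Suc l)"
      using P_Omega_nonempty[OF prep(2)] P_Omega_length[OF prep(2)] by auto
    have i: "i \<le> Suc (l + m)" using prep(1) Suc.prems(2) by simp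
    have "butlast \<nu> \<in> P_Omega (Suc l) m"
      using prep(2,3) i by (intro Suc.IH) auto
    moreover have "hd (butlast \<nu>) = hd \<nu>"
      using \<nu> by (cases \<nu>) auto
    ultimately have "i # map Suc (butlast \<nu>) \<in> P_Omega (Suc (Suc l)) m"
      using prep(3) i by (intro prepend_in_P_Omega) auto
    then show ?thesis using prep(1) \<nu> by (simp add: map_butlast)
  qed simp
qed

text \<open>Each of the two constructions leaves room at one end: appending a part keeps the first
  part at the old, smaller bound, and prepending one has raised the last part above 1.\<close>

lemma P_Omega_not_extremal:
  assumes "\<mu> \<in> P_Omega (Suc (Suc l)) m"
  shows "hd \<mu> \<le> l + m \<or> 1 < last \<mu>"
  using assms
proof (cases rule: P_Omega_Suc_Suc_cases)
  case (app \<nu> j)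
  then show ?thesis using P_Omega_hd_le[OF app(2)] P_Omega_nonempty[OF app(2)] by simp
next
  case (prep \<nu> i)
  then show ?thesis using P_Omega_last_pos[OF prep(2)] P_Omega_nonempty[OF prep(2)]
    by (simp add: last_map)
qed

section \<open>Recursions for the members with prescribed slack\<close>

text \<open>The parameters \<open>p\<close> and \<open>q\<close> demand room above the first and below the last part. They make
  the count inductive: removing the last part lowers the bound on all parts by one, and thus uses up
  one unit of \<open>p\<close>, while the removed part itself interacts with \<open>q\<close>.\<close>

definition P_slack :: "nat \<Rightarrow> nat \<Rightarrow> nat \<Rightarrow> nat \<Rightarrow> nat list set" where
  "P_slack l m p q = {\<mu> \<in> P_Omega (Suc l) m. hd \<mu> + p \<le> l + m \<and> q < last \<mu>}"

lemma finite_P_slack: "finite (P_slack l m p q)"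
  by (rule finite_subset[OF _ finite_partitions[of "Suc l" "l + m"]])
     (use P_Omega_subset_partitions[of l m] in \<open>auto simp: P_slack_def\<close>)

lemma P_slack_0_0: "P_slack l m 0 0 = P_Omega (Suc l) m"
  by (auto simp: P_slack_def P_Omega_hd_le P_Omega_last_pos)

lemma card_P_slack_commute: "card (P_slack l m p q) = card (P_slack l m q p)"
proof (rule bij_betw_same_card)
  have *: "tau (l + m) \<mu> \<in> P_slack l m q p" if "\<mu> \<in> P_slack l m p q" for \<mu> p q
    using that P_Omega_tau[of \<mu> l m] P_Omega_nonempty[of \<mu> l m] P_Omega_last_le[of \<mu> l m]
    by (auto simp: P_slack_def hd_tau last_tau)
  have "tau (l + m) (tau (l + m) \<mu>) = \<mu>" if "\<mu> \<in> P_slack l m p q" for \<mu> p q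
    using that P_Omega_subset_partitions[of l m] tau_tau by (auto simp: P_slack_def)
  with * show "bij_betw (tau (l + m)) (P_slack l m p q) (P_slack l m q p)"
    by (intro bij_betw_byWitness[where f' = "tau (l + m)"]) auto
qed

text \<open>Strengthening the bound from \<open>q\<close> to \<open>Suc q\<close> loses exactly the members with last part
  \<open>Suc q\<close>. A positive slack above the first part allows that part to be removed by confluence.\<close>

lemma card_P_slack_Suc:
  "card (P_slack (Suc l) m (Suc p) q) =
     card (P_slack (Suc l) m (Suc p) (Suc q)) + card (P_slack l m p q)"
proof -
  let ?f = "\<lambda>\<nu>. \<nu> @ [Suc q]"
  have "?f \<nu> \<in> P_slack (Suc l) m (Suc p) q" if "\<nu> \<in> P_slack l m p q" for \<nu>
    using that P_Omega_nonempty[of \<nu> l m]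
    by (auto simp: P_slack_def intro: append_in_P_Omega)
  moreover have "\<mu> \<in> ?f ` P_slack l m p q"
    if "\<mu> \<in> P_slack (Suc l) m (Suc p) q" "\<mu> \<notin> P_slack (Suc l) m (Suc p) (Suc q)" for \<mu>
  proof
    from that have \<mu>: "\<mu> \<in> P_Omega (Suc (Suc l)) m" "hd \<mu> + p \<le> l + m" "last \<mu> = Suc q"
      by (auto simp: P_slack_def)
    have b: "butlast \<mu> \<in> P_Omega (Suc l) m" using \<mu> by (intro butlast_in_P_Omega) auto
    show eq: "\<mu> = ?f (butlast \<mu>)"
      using \<mu>(3) P_Omega_nonempty[OF \<mu>(1)] by (metis append_butlast_last_id)
    have hd: "hd (butlast \<mu>) = hd \<mu>"
      using P_Omega_length[OF \<mu>(1)] by (cases \<mu>) auto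
    have "sorted_wrt (\<ge>) (butlast \<mu> @ [Suc q])"
      using P_Omega_subset_partitions[of "Suc l" m] \<mu>(1) eq
      by (auto simp: partitions_def is_partition_def)
    then have "Suc q \<le> last (butlast \<mu>)"
      using P_Omega_nonempty[OF b] by (simp add: sorted_wrt_append)
    then show "butlast \<mu> \<in> P_slack l m p q"
      using b hd \<mu>(2) by (simp add: P_slack_def)
  qed
  moreover have "P_slack (Suc l) m (Suc p) (Suc q) \<subseteq> P_slack (Suc l) m (Suc p) q"
    by (auto simp: P_slack_def)
  ultimately have "P_slack (Suc l) m (Suc p) q =
      P_slack (Suc l) m (Suc p) (Suc q) \<union> ?f ` P_slack l m p q"
    by blast
  moreover have "P_slack (Suc l) m (Suc p) (Suc q) \<inter> ?f ` P_slack l m p q = {}"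
    by (auto simp: P_slack_def)
  moreover have "card (?f ` P_slack l m p q) = card (P_slack l m p q)"
    by (intro card_image inj_onI) simp
  ultimately show ?thesis
    by (simp add: card_Un_disjoint finite_P_slack)
qed

text \<open>Inclusion and exclusion: without extremal members, every member has slack at one of its
  ends.\<close>

lemma card_P_slack_0_0:
  "card (P_slack (Suc l) m 0 0) + card (P_slack (Suc l) m 1 1) =
     card (P_slack (Suc l) m 1 0) + card (P_slack (Suc l) m 0 1)"
proof -
  have "P_slack (Suc l) m 0 0 = P_slack (Suc l) m 1 0 \<union> P_slack (Suc l) m 0 1"
    using P_Omega_not_extremal[of _ l m]
    by (auto simp: P_slack_def P_Omega_hd_le P_Omega_last_pos)
  moreover have "P_slack (Suc l) m 1 1 = P_slack (Suc l) m 1 0 \<inter> P_slack (Suc l) m 0 1"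
    by (auto simp: P_slack_def)
  ultimately show ?thesis
    by (metis card_Un_Int finite_P_slack)
qed

section \<open>The closed form\<close>

text \<open>For \<open>p + q < l + m\<close>, a partition with \<open>Suc l\<close> parts in \<open>{q<..l + m - p}\<close> is a lattice
  path of \<open>n = 2 * l + m - p - q\<close> steps, \<open>Suc l\<close> of them for the parts. From their number the formula
  subtracts the number of paths in which \<open>Suc l + m\<close> steps are of that kind.\<close>

definition reflection_count :: "nat \<Rightarrow> nat \<Rightarrow> nat \<Rightarrow> int" where
  "reflection_count l m n = int (n choose Suc l) - int (n choose (Suc l + m))"

lemma reflection_count_Suc:
  "reflection_count (Suc l) m (Suc n) = reflection_count (Suc l) m n + reflection_count l m n"
  by (simp add: reflection_count_def)

text \<open>This is the counterpart of \<open>card_P_slack_0_0\<close>: the second difference of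
  \<open>n choose Suc (Suc l)\<close> is \<open>(2 * l + m) choose l\<close>, that of \<open>n choose (Suc (Suc l) + m)\<close> is
  \<open>(2 * l + m) choose (l + m)\<close>, and these two agree by symmetry.\<close>

lemma reflection_count_center:
  "reflection_count (Suc l) m (2 * Suc l + m) + reflection_count (Suc l) m (2 * l + m) =
     2 * reflection_count (Suc l) m (Suc (2 * l + m))"
proof -
  have "2 * l + m choose l = 2 * l + m choose (l + m)"
    by (subst binomial_symmetric) auto
  then show ?thesis
    by (simp add: reflection_count_def)
qed

text \<open>The recursion in \<open>q\<close> for positive \<open>p\<close> runs downwards from the values of \<open>q\<close> that exceed all
  parts, where both sides vanish. The remaining cases \<open>p = 0\<close> follow from it by the symmetry in \<open>p\<close>
  and \<open>q\<close>, and for \<open>q = 0\<close> by inclusion and exclusion.\<close>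

lemma card_P_slack: "int (card (P_slack l m p q)) = reflection_count l m (2 * l + m - p - q)"
proof (induction l arbitrary: p q)
  case 0
  have "P_slack 0 m p q = (\<lambda>x. [x]) ` {q<..m - p}" if "p \<le> m"
    using that by (auto simp: P_slack_def P_Omega_one partitions_def is_partition_def length_Suc_conv)
  moreover have "P_slack 0 m p q = {}" if "\<not> p \<le> m"
    using that by (auto simp: P_slack_def)
  ultimately have "card (P_slack 0 m p q) = m - p - q"
    by (cases "p \<le> m") (auto simp: card_image inj_on_def)
  then show ?case by (simp add: reflection_count_def binomial_eq_0)
next
  case (Suc l)
  have pos: "int (card (P_slack (Suc l) m (Suc p) q)) =
      reflection_count (Suc l) m (2 * Suc l + m - Suc p - q)" for p q
  proof (induction "Suc l + m - q" arbitrary: q rule: less_induct)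
    case less
    show ?case
    proof (cases "Suc l + m \<le> q")
      case True
      then have "P_slack (Suc l) m (Suc p) q = {}"
        by (auto simp: P_slack_def dest!: P_Omega_last_le)
      moreover have "2 * Suc l + m - Suc p - q < Suc (Suc l)" using True by simp
      ultimately show ?thesis by (simp add: reflection_count_def binomial_eq_0)
    next
      case False
      then have step: "int (card (P_slack (Suc l) m (Suc p) (Suc q))) =
          reflection_count (Suc l) m (2 * Suc l + m - Suc p - Suc q)"
        by (intro less) simp
      show ?thesis
      proof (cases "2 * Suc l + m - Suc p - q")
        \<comment> \<open>Pascal's rule fails at path length 0, where the subtractions are truncated; there all
          terms are 0.\<close>
        case 0
        then show ?thesis
          using step Suc.IH[of p q] card_P_slack_Suc[of l m p q]
          by (simp add: reflection_count_def)
      next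
        case (Suc n)
        then have "2 * Suc l + m - Suc p - Suc q = n" "2 * l + m - p - q = n" by auto
        with step Suc.IH[of p q] Suc show ?thesis
          using card_P_slack_Suc[of l m p q] by (simp only: of_nat_add reflection_count_Suc)
      qed
    qed
  qed
  show ?case
  proof (cases p)
    case 0
    show ?thesis
    proof (cases q)
      case 0
      have "int (card (P_slack (Suc l) m 0 0)) + reflection_count (Suc l) m (2 * l + m) =
          2 * reflection_count (Suc l) m (Suc (2 * l + m))"
        using card_P_slack_0_0[of l m] pos[of 0 0] pos[of 0 1]
          card_P_slack_commute[of "Suc l" m 0 1] by simp
      then show ?thesis
        using reflection_count_center[of l m] \<open>p = 0\<close> \<open>q = 0\<close> by simp
    next
      case (Suc q')
      then show ?thesis
        using pos[of q' 0] card_P_slack_commute[of "Suc l" m 0 q] \<open>p = 0\<close> by simp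
    qed
  next
    case (Suc p')
    then show ?thesis using pos[of p' q] by simp
  qed
qed

theorem mainTheorem2:
  fixes l m :: nat
  assumes "l \<ge> 1" and "m \<ge> 1"
  shows "int (card (P_Omega l m)) = ballot l (m - 1)"
proof -
  obtain k n where l: "l = Suc k" and m: "m = Suc n"
    using assms by (metis Suc_le_D One_nat_def)
  have "int (card (P_Omega l m)) = reflection_count k m (2 * k + m)"
    using card_P_slack[of k m 0 0] by (simp add: P_slack_0_0 l m)
  also have "\<dots> = ballot l (m - 1)"
  proof -
    have "2 * k + Suc n choose k = 2 * k + Suc n choose (k + Suc n)"
      by (subst binomial_symmetric) auto
    moreover have "Suc (2 * k + Suc n) choose k = Suc (2 * k + Suc n) choose Suc (k + Suc n)"
      by (subst binomial_symmetric) auto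
    ultimately show ?thesis
      by (simp add: l m ballot_def reflection_count_def)
  qed
  finally show ?thesis .
qed

end
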